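(* Let $d\ge 1$. There is a constant $c_d>0$ depending only on $d$ such that the following holds. Given an open convex body $K\subset\mathbb{R}^d$, $\delta\in(0,1/2]$ sufficiently small such that $K_\delta\neq\emptyset$, and $\varepsilon\in(0,1)$, there is a data structure that answers the $\varepsilon$-approximate membership query for the $\delta$-depth-trimmed region of $K$ (for every query point $q\in\mathbb{R}^d$), with storage space at most $c_d\,\dfrac{1}{\varepsilon^{d}\,\delta^{(3d-1)/2}}$ and query time at most $c_d\,\dfrac{1}{\varepsilon\,\delta}\ln\dfrac1\delta$.
   Context: An open convex body is a nonempty, bounded, open convex subset of $\mathbb{R}^d$. $|S|$ denotes Lebesgue volume. The halfspace depth of $q\in\mathbb{R}^d$ with respect to $K$ is $$D_K(q)=\inf\left\{\frac{|\{z\in K:\langle v,z-q\rangle\ge 0\}|}{|K|}: v\in\mathbb{R}^d,\ \|v\|=1\right\},$$ and for $\delta\in(0,1/2]$ the $\delta$-depth-trimmed region of $K$ is $K_\delta=\{q\in\mathbb{R}^d: D_K(q)\ge\delta\}$ (the same formula defines $K_{(1-\varepsilon)\delta}$). The $\varepsilon$-approximate membership query for the $\delta$-depth-trimmed region of $K$ is the following problem: given $q\in\mathbb{R}^d$, return "Yes" if $q\in K_\delta$, return "No" if $q\notin K_{(1-\varepsilon)\delta}$, and return either answer otherwise. The data structure is allowed to depend on $K,\delta,\varepsilon$ (but not on $q$). The statement concerns only the existence of the data structure; its construction (preprocessing) time is not counted. Storage space is the number of units (real numbers, integers, pointers) stored, and query time is the number of elementary operations (arithmetic operations and comparisons on reals,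 memory accesses) performed to answer a query. The dimension $d$ is treated as fixed, so that storing or manipulating a point or an ellipsoid in $\mathbb{R}^d$ costs a constant depending only on $d$. *)

theory Defs
  imports "HOL-Analysis.Analysis"
begin

section \<open>Halfspace depth and trimmed regions\<close>

definition open_convex_body :: "(real ^ 'n) set \<Rightarrow> bool" where
  "open_convex_body K \<longleftrightarrow> K \<noteq> {} \<and> bounded K \<and> open K \<and> convex K"

definition halfspace_depth :: "(real ^ 'n) set \<Rightarrow> real ^ 'n \<Rightarrow> real" where
  "halfspace_depth K q =
     Inf {measure lebesgue {z \<in> K. v \<bullet> (z - q) \<ge> 0} / measure lebesgue K | v. norm v = 1}"

definition trimmed_region :: "(real ^ 'n) set \<Rightarrow> real \<Rightarrow> (real ^ 'n) set" where
  "trimmed_region K \<delta> = {q. halfspace_depth K q \<ge> \<delta>}"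

definition valid_answer :: "(real ^ 'n) set \<Rightarrow> real \<Rightarrow> real \<Rightarrow> real ^ 'n \<Rightarrow> bool \<Rightarrow> bool" where
  "valid_answer K \<delta> \<epsilon> q b \<longleftrightarrow>
     (q \<in> trimmed_region K \<delta> \<longrightarrow> b) \<and>
     (q \<notin> trimmed_region K ((1 - \<epsilon>) * \<delta>) \<longrightarrow> \<not> b)"


section \<open>A unit-cost random access machine over the reals\<close>

text \<open>
  Memory is a sequence of cells, each holding one real number. Integers and pointers are the
  reals with an integer, respectively natural number, value. The instruction set offers exactly
  arithmetic, comparison and (direct or indirect) memory access; in particular there is no
  rounding operation and no root extraction.
\<close>

type_synonym memory = "nat \<Rightarrow> real"

datatype instr =
    Const nat real
  | Move nat nat
  | Add nat nat nat
  | Sub nat nat nat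
  | Mul nat nat nat
  | Div nat nat nat
  | Load nat nat
  | Store nat nat
  | Jump nat
  | Jump_Less nat nat nat
  | Answer bool

text \<open>
  \<open>next_state\<close> yields \<open>None\<close> if the instruction answers or faults. Faults are divisions by zero and
  indirect accesses through a cell whose value is not a natural number (so that addressing
  cannot serve as a rounding operation).
\<close>

fun next_state :: "instr \<Rightarrow> nat \<times> memory \<Rightarrow> (nat \<times> memory) option" where
  "next_state (Const i r) (pc, M) = Some (Suc pc, M(i := r))"
| "next_state (Move i j) (pc, M) = Some (Suc pc, M(i := M j))"
| "next_state (Add i j k) (pc, M) = Some (Suc pc, M(i := M j + M k))"
| "next_state (Sub i j k) (pc, M) = Some (Suc pc, M(i := M j - M k))"
| "next_state (Mul i j k) (pc, M) = Some (Suc pc, M(i := M j * M k))"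
| "next_state (Div i j k) (pc, M) =
     (if M k = 0 then None else Some (Suc pc, M(i := M j / M k)))"
| "next_state (Load i j) (pc, M) =
     (if M j \<in> \<nat> then Some (Suc pc, M(i := M (nat \<lfloor>M j\<rfloor>))) else None)"
| "next_state (Store i j) (pc, M) =
     (if M i \<in> \<nat> then Some (Suc pc, M(nat \<lfloor>M i\<rfloor> := M j)) else None)"
| "next_state (Jump l) (pc, M) = Some (l, M)"
| "next_state (Jump_Less i j l) (pc, M) = Some (if M i < M j then l else Suc pc, M)"
| "next_state (Answer b) (pc, M) = None"

text \<open>
  \<open>exec P s n b\<close>: from state \<open>s\<close>, the program \<open>P\<close> stops after executing exactly \<open>n\<close> instructions
  and returns \<open>b\<close>. Runs that fault, leave the program or do not terminate have no result.
\<close>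

inductive exec :: "instr list \<Rightarrow> nat \<times> memory \<Rightarrow> nat \<Rightarrow> bool \<Rightarrow> bool" for P where
  answer: "pc < length P \<Longrightarrow> P ! pc = Answer b \<Longrightarrow> exec P (pc, M) 1 b"
| step: "pc < length P \<Longrightarrow> next_state (P ! pc) (pc, M) = Some s \<Longrightarrow> exec P s n b \<Longrightarrow>
    exec P (pc, M) (Suc n) b"

lemma exec_deterministic:
  "exec P s n b \<Longrightarrow> exec P s n' b' \<Longrightarrow> n = n' \<and> b = b'"
proof (induction arbitrary: n' b' rule: exec.induct)
  case (answer pc b M)
  from answer.prems answer.hyps show ?case by (cases rule: exec.cases) simp_all
next
  case (step pc M s n b)
  note IH = step.IH and next_eq = step.hyps(2)
  from step.prems show ?case
  proof (cases rule: exec.cases)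
    case answer
    with step.hyps show ?thesis by simp
  next
    case (step s' m)
    with next_eq have "exec P s m b'" by simp
    from IH[OF this] step show ?thesis by simp
  qed
qed


section \<open>Data structures\<close>

text \<open>
  Both the table and the query program may be chosen depending on the instance, so both are
  charged as storage: otherwise arbitrary tables could be hidden in the program for free. An
  instruction has at most three operands and performs a bounded number of elementary operations;
  charging one unit of storage and one unit of time for it changes the counts only by an
  absolute constant factor.
\<close>

record data_structure =
  table :: "real list"
  program :: "instr list"

definition storage_space :: "data_structure \<Rightarrow> nat" where
  "storage_space D = length (table D) + length (program D)"

text \<open>An index type of class \<open>finite\<close> carries no order, so some numbering of it is fixed.\<close>

definition coord :: "nat \<Rightarrow> 'n::finite" where
  "coord = (SOME e. bij_betw e {0..<CARD('n)} UNIV)"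

lemma bij_betw_coord: "bij_betw (coord :: nat \<Rightarrow> 'n::finite) {0..<CARD('n)} UNIV"
  unfolding coord_def
  by (rule someI_ex[where P = "\<lambda>e. bij_betw e {0..<CARD('n)} (UNIV :: 'n set)"])
    (rule ex_bij_betw_nat_finite[OF finite_class.finite_UNIV])

text \<open>
  Every query starts from the same stored table, preceded by the coordinates of the query point;
  all further cells are scratch space, initially zero.
\<close>

definition initial_memory :: "data_structure \<Rightarrow> real ^ 'n \<Rightarrow> memory" where
  "initial_memory D q i =
     (if i < CARD('n) then q $ coord i
      else if i < CARD('n) + length (table D) then table D ! (i - CARD('n))
      else 0)"

text \<open>By determinism of \<^const>\<open>exec\<close>, the time \<open>n\<close> and the answer \<open>b\<close> are unique.\<close>

definition query_result :: "data_structure \<Rightarrow> real ^ 'n \<Rightarrow> nat \<Rightarrow> bool \<Rightarrow> bool" where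
  "query_result D q n b \<longleftrightarrow> exec (program D) (0, initial_memory D q) n b"

end

theory Submission
  imports Defs
begin

text \<open>
  Since $d \le (3d-1)/2$, the storage bound leaves room for a uniform grid with
  $(C/(\varepsilon\delta))^d$ cells. Fix $x_0 \in K$ and choose $x_1, \dots, x_d$ in the closure of
  $K$ maximising $|\det(x_i - x_0)|$. By Cramer's rule every point of $K$ has coordinates in
  $[-1,1]$ with respect to $x_0$ and the vectors $x_i - x_0$, while the points with coordinates in
  $[0,1/d]$ are convex combinations of the $x_i$; so the enclosing parallelepiped has volume at
  most $(2d)^d|K|$. In these coordinates a slab of small width takes up a small fraction of $K$,
  hence moving a point by $O(\varepsilon\delta)$ in each coordinate lowers its depth by at most
  $\varepsilon\delta$, and a grid cell may answer "Yes" as soon as it meets $K_\delta$. The grid is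
  searched by scanning the coordinates one after another; this decision tree is written out as
  the program itself, so that no table is needed.
\<close>

section \<open>Linear decision trees\<close>

datatype 'a dtree = Leaf bool | Node 'a real "'a dtree" "'a dtree"

text \<open>The left branch is the strict case, matching the test made by \<open>Jump_Less\<close>;
  equality goes to the right.\<close>

primrec decide :: "'a::real_inner dtree \<Rightarrow> 'a \<Rightarrow> bool" where
  "decide (Leaf b) q = b"
| "decide (Node \<alpha> \<beta> l r) q = (if \<alpha> \<bullet> q < \<beta> then decide l q else decide r q)"

primrec node_count :: "'a dtree \<Rightarrow> nat" where
  "node_count (Leaf b) = 1"
| "node_count (Node \<alpha> \<beta> l r) = 1 + node_count l + node_count r"

primrec depth :: "'a dtree \<Rightarrow> nat" where
  "depth (Leaf b) = 0"
| "depth (Node \<alpha> \<beta> l r) = 1 + max (depth l) (depth r)"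

text \<open>
  The query is compared with the last threshold first, so a query below \<open>\<beta>\<close> falls through to
  \<open>Leaf False\<close>, whereas one at or above \<open>\<beta> + m\<close> wrongly ends up in the last slice.
\<close>
primrec slices :: "'a \<Rightarrow> real \<Rightarrow> (nat \<Rightarrow> 'a dtree) \<Rightarrow> nat \<Rightarrow> 'a dtree" where
  "slices \<alpha> \<beta> T 0 = Leaf False"
| "slices \<alpha> \<beta> T (Suc m) = Node \<alpha> (\<beta> + real m) (slices \<alpha> \<beta> T m) (T m)"

text \<open>The slices are half-open, so at most one index qualifies. In the induction the top test
  either passes the query on to the lower slices or leaves slice \<open>m\<close> as the only
  candidate.\<close>

lemma decide_slices:
  assumes "\<alpha> \<bullet> q < \<beta> + real m"
  shows "decide (slices \<alpha> \<beta> T m) q \<longleftrightarrow>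
    (\<exists>i<m. \<beta> + real i \<le> \<alpha> \<bullet> q \<and> \<alpha> \<bullet> q < \<beta> + real i + 1 \<and> decide (T i) q)"
  using assms
proof (induction m)
  case (Suc m)
  show ?case
  proof (cases "\<alpha> \<bullet> q < \<beta> + real m")
    case True
    with Suc.IH show ?thesis by (auto simp: less_Suc_eq)
  next
    case False
    have "i = m" if "i < Suc m" "\<alpha> \<bullet> q < \<beta> + real i + 1" for i
    proof -
      have "real m < real i + 1" using that False by linarith
      with that show ?thesis by linarith
    qed
    then have "(\<exists>i<Suc m. \<beta> + real i \<le> \<alpha> \<bullet> q \<and> \<alpha> \<bullet> q < \<beta> + real i + 1 \<and> decide (T i) q) \<longleftrightarrow>
      \<beta> + real m \<le> \<alpha> \<bullet> q \<and> \<alpha> \<bullet> q < \<beta> + real m + 1 \<and> decide (T m) q" by blast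
    with False Suc.prems show ?thesis by (simp add: add_ac)
  qed
qed simp

lemma node_count_slices:
  assumes "\<And>i. i < m \<Longrightarrow> node_count (T i) \<le> s"
  shows "node_count (slices \<alpha> \<beta> T m) \<le> m * (s + 1) + 1"
  using assms
proof (induction m)
  case (Suc m)
  from Suc.IH Suc.prems have "node_count (slices \<alpha> \<beta> T m) \<le> m * (s + 1) + 1" by simp
  moreover have "node_count (T m) \<le> s" using Suc.prems by simp
  ultimately show ?case by simp
qed simp

text \<open>A query passes at most \<open>m\<close> thresholds and then enters a single subtree.
  Hence the depths of successive scans add up, while their sizes multiply.\<close>

lemma depth_slices:
  assumes "\<And>i. i < m \<Longrightarrow> depth (T i) \<le> h"
  shows "depth (slices \<alpha> \<beta> T m) \<le> m + h"
  using assms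
proof (induction m)
  case (Suc m)
  from Suc.IH Suc.prems have "depth (slices \<alpha> \<beta> T m) \<le> m + h" by simp
  moreover have "depth (T m) \<le> h" using Suc.prems by simp
  ultimately show ?case by simp
qed simp

text \<open>Each functional is scanned in unit steps, and the part of \<open>P\<close> inside a
  slice is handed to the tree below it. The tree thus accepts the unit cells that meet
  \<open>P\<close>, and an accepted query shares its cell with a point of \<open>P\<close>.
  \<open>P\<close> may be arbitrary, since the leaves record which cells meet it.\<close>

lemma grid_dtree:
  fixes P :: "'a::real_inner set"
  assumes "m \<ge> 1"
    and "\<And>p \<alpha> \<beta>. p \<in> P \<Longrightarrow> (\<alpha>, \<beta>) \<in> set fs \<Longrightarrow> \<beta> \<le> \<alpha> \<bullet> p \<and> \<alpha> \<bullet> p < \<beta> + real m"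
  shows "\<exists>t. node_count t \<le> (5 * m) ^ length fs \<and> depth t \<le> length fs * (m + 1) \<and>
    (\<forall>q\<in>P. decide t q) \<and>
    (\<forall>q. decide t q \<longrightarrow> (\<exists>p\<in>P. \<forall>(\<alpha>, \<beta>)\<in>set fs. \<bar>\<alpha> \<bullet> q - \<alpha> \<bullet> p\<bar> < 1))"
  using assms(2)
proof (induction fs arbitrary: P)
  case Nil
  \<comment> \<open>After all functionals have been scanned, \<open>P\<close> has shrunk to its part
    in one cell, and the leaf records whether anything is left.\<close>
  show ?case by (rule exI[of _ "Leaf (P \<noteq> {})"]) auto
next
  case (Cons f fs)
  obtain \<alpha> \<beta> where f: "f = (\<alpha>, \<beta>)" by (cases f)
  define s where "s = (5 * m) ^ length fs"
  define h where "h = length fs * (m + 1)"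
  define Q where "Q i = {p \<in> P. \<beta> + real i \<le> \<alpha> \<bullet> p \<and> \<alpha> \<bullet> p < \<beta> + real i + 1}" for i
  have "\<forall>i. \<exists>t. node_count t \<le> s \<and> depth t \<le> h \<and> (\<forall>q\<in>Q i. decide t q) \<and>
    (\<forall>q. decide t q \<longrightarrow> (\<exists>p\<in>Q i. \<forall>(\<alpha>, \<beta>)\<in>set fs. \<bar>\<alpha> \<bullet> q - \<alpha> \<bullet> p\<bar> < 1))"
    unfolding s_def h_def by (intro allI Cons.IH) (use Cons.prems in \<open>auto simp: Q_def\<close>)
  from choice[OF this] obtain T where "\<forall>i. node_count (T i) \<le> s \<and> depth (T i) \<le> h \<and> (\<forall>q\<in>Q i. decide (T i) q) \<and>
    (\<forall>q. decide (T i) q \<longrightarrow> (\<exists>p\<in>Q i. \<forall>(\<alpha>, \<beta>)\<in>set fs. \<bar>\<alpha> \<bullet> q - \<alpha> \<bullet> p\<bar> < 1))"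
    by blast
  then have T: "\<And>i. node_count (T i) \<le> s" "\<And>i. depth (T i) \<le> h"
      "\<And>i q. q \<in> Q i \<Longrightarrow> decide (T i) q"
      "\<And>i q. decide (T i) q \<Longrightarrow> \<exists>p\<in>Q i. \<forall>(\<alpha>, \<beta>)\<in>set fs. \<bar>\<alpha> \<bullet> q - \<alpha> \<bullet> p\<bar> < 1"
    by simp_all
  \<comment> \<open>The extra root rejects values from \<open>\<beta> + real m\<close> on, which
    \<open>slices\<close> would misplace.\<close>
  let ?t = "Node \<alpha> (\<beta> + real m) (slices \<alpha> \<beta> T m) (Leaf False)"
  \<comment> \<open>The factor 5 arises here: in \<open>m * s + m + 3\<close> both \<open>m\<close>
    and 1 are at most \<open>m * s\<close>.\<close>
  have "s \<ge> 1" using \<open>m \<ge> 1\<close> by (simp add: s_def)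
  then have "m * s \<ge> m" "m * s \<ge> 1" using \<open>m \<ge> 1\<close> by simp_all
  moreover have "node_count ?t \<le> m * s + m + 3"
    using node_count_slices[of m T s \<alpha> \<beta>] T(1) by (simp add: algebra_simps)
  ultimately have "node_count ?t \<le> 5 * (m * s)" by linarith
  then have "node_count ?t \<le> (5 * m) ^ length (f # fs)" by (simp add: s_def)
  moreover have "depth ?t \<le> length (f # fs) * (m + 1)"
    using depth_slices[of m T h \<alpha> \<beta>] T(2) by (simp add: h_def)
  moreover have "decide ?t q" if "q \<in> P" for q
  proof -
    from Cons.prems[OF that, of \<alpha> \<beta>] have b: "\<beta> \<le> \<alpha> \<bullet> q" "\<alpha> \<bullet> q < \<beta> + real m" by (simp_all add: f)
    \<comment> \<open>Rounding occurs only in this argument; the tree finds the slice by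
      comparisons.\<close>
    define i where "i = nat \<lfloor>\<alpha> \<bullet> q - \<beta>\<rfloor>"
    have "real i = \<lfloor>\<alpha> \<bullet> q - \<beta>\<rfloor>" using b by (simp add: i_def)
    then have i: "\<beta> + real i \<le> \<alpha> \<bullet> q" "\<alpha> \<bullet> q < \<beta> + real i + 1" by linarith+
    with b have "i < m" by linarith
    moreover have "q \<in> Q i" using that i by (simp add: Q_def)
    then have "decide (T i) q" by (rule T(3))
    ultimately have "decide (slices \<alpha> \<beta> T m) q"
      using i by (subst decide_slices[OF b(2)]) blast
    with b(2) show ?thesis by simp
  qed
  moreover have "\<exists>p\<in>P. \<forall>(\<alpha>, \<beta>)\<in>set (f # fs). \<bar>\<alpha> \<bullet> q - \<alpha> \<bullet> p\<bar> < 1" if "decide ?t q" for q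
  proof -
    from that have "\<alpha> \<bullet> q < \<beta> + real m" "decide (slices \<alpha> \<beta> T m) q" by (simp_all split: if_splits)
    then obtain i where i: "\<beta> + real i \<le> \<alpha> \<bullet> q" "\<alpha> \<bullet> q < \<beta> + real i + 1" "decide (T i) q"
      by (auto simp: decide_slices)
    from T(4)[OF i(3)] obtain p where p: "p \<in> Q i" "\<forall>(\<alpha>, \<beta>)\<in>set fs. \<bar>\<alpha> \<bullet> q - \<alpha> \<bullet> p\<bar> < 1" by blast
    then have "\<beta> + real i \<le> \<alpha> \<bullet> p" "\<alpha> \<bullet> p < \<beta> + real i + 1" by (simp_all add: Q_def)
    with i have "\<bar>\<alpha> \<bullet> q - \<alpha> \<bullet> p\<bar> < 1" by linarith
    with p show ?thesis by (auto simp: f Q_def)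
  qed
  ultimately show ?case by blast
qed

section \<open>Compilation to the random access machine\<close>

text \<open>Jump targets are absolute, so a fragment has to be reasoned about at its position in the
  whole program.\<close>

definition code_at :: "instr list \<Rightarrow> nat \<Rightarrow> instr list \<Rightarrow> bool" where
  "code_at P pc c \<longleftrightarrow> (\<exists>xs zs. P = xs @ c @ zs \<and> length xs = pc)"

lemma code_at_appendD:
  assumes "code_at P pc (c @ c')"
  shows "code_at P pc c" "code_at P (pc + length c) c'"
proof -
  from assms obtain xs zs where P: "P = xs @ (c @ c') @ zs" "length xs = pc"
    by (auto simp: code_at_def)
  show "code_at P pc c" unfolding code_at_def
    by (rule exI[of _ xs], rule exI[of _ "c' @ zs"]) (simp add: P)
  show "code_at P (pc + length c) c'" unfolding code_at_def
    by (rule exI[of _ "xs @ c"], rule exI[of _ zs]) (simp add: P)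
qed

lemma code_at_ConsD:
  assumes "code_at P pc (i # c)"
  shows "pc < length P" "P ! pc = i" "code_at P (Suc pc) c"
proof -
  from assms obtain xs zs where "P = xs @ (i # c) @ zs" "length xs = pc"
    by (auto simp: code_at_def)
  then show "pc < length P" "P ! pc = i" by auto
  show "code_at P (Suc pc) c"
    using assms code_at_appendD(2)[of P pc "[i]" c] by simp
qed

lemma exec_Cons:
  assumes "code_at P pc (i # c)" "next_state i (pc, M) = Some s" "exec P s n b"
  shows "exec P (pc, M) (Suc n) b"
  using assms code_at_ConsD[OF assms(1)] by (auto intro: exec.step)

text \<open>Cells \<open>0, \<dots>, d - 1\<close> hold the query point, cell \<open>d\<close> accumulates the sum, cell \<open>d + 1\<close> is scratch.\<close>
fun dot_code :: "nat \<Rightarrow> (nat \<Rightarrow> real) \<Rightarrow> nat list \<Rightarrow> instr list" where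
  "dot_code d a [] = []"
| "dot_code d a (j # js) =
     Const (Suc d) (a j) # Mul (Suc d) (Suc d) j # Add d d (Suc d) # dot_code d a js"

lemma length_dot_code: "length (dot_code d a js) = 3 * length js"
  by (induction js) auto

text \<open>\<open>exec\<close> only describes runs that end in an answer. A fragment that does not
  answer is therefore specified by how it prolongs every run starting behind it. It writes only to
  cells \<open>d\<close> and \<open>Suc d\<close>, so the query point survives.\<close>

lemma exec_dot_code:
  assumes "code_at P pc (dot_code d a js)" "\<And>j. j < d \<Longrightarrow> M j = x j" "\<And>j. j \<in> set js \<Longrightarrow> j < d"
  shows "\<exists>M'. (\<forall>j<d. M' j = x j) \<and> M' d = M d + (\<Sum>j\<leftarrow>js. a j * x j) \<and>
    (\<forall>n b. exec P (pc + 3 * length js, M') n b \<longrightarrow> exec P (pc, M) (3 * length js + n) b)"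
  using assms
proof (induction js arbitrary: pc M)
  case Nil
  then show ?case by auto
next
  case (Cons j js)
  let ?M = "M(Suc d := a j * M j, d := M d + a j * M j)"
  from Cons.prems(3) have j: "j < d" by simp
  from Cons.prems(1) have c0: "code_at P pc (Const (Suc d) (a j) # Mul (Suc d) (Suc d) j # Add d d (Suc d) # dot_code d a js)"
    by simp
  note c1 = code_at_ConsD(3)[OF c0]
  note c2 = code_at_ConsD(3)[OF c1]
  note c3 = code_at_ConsD(3)[OF c2]
  have *: "exec P (pc, M) (3 + n) b" if "exec P (pc + 3, ?M) n b" for n b
  proof -
    have "exec P (Suc (Suc pc), M(Suc d := a j * M j)) (Suc n) b"
      by (rule exec_Cons[OF c2 _ that]) (use j in \<open>auto simp: fun_eq_iff\<close>)
    then have "exec P (Suc pc, M(Suc d := a j)) (Suc (Suc n)) b"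
      by (rule exec_Cons[OF c1, rotated]) (use j in \<open>auto simp: fun_eq_iff\<close>)
    then have "exec P (pc, M) (Suc (Suc (Suc n))) b"
      by (rule exec_Cons[OF c0, rotated]) auto
    then show ?thesis by (simp add: numeral_3_eq_3)
  qed
  have "\<exists>M'. (\<forall>j<d. M' j = x j) \<and> M' d = ?M d + (\<Sum>j\<leftarrow>js. a j * x j) \<and>
    (\<forall>n b. exec P (Suc (Suc (Suc pc)) + 3 * length js, M') n b \<longrightarrow>
      exec P (Suc (Suc (Suc pc)), ?M) (3 * length js + n) b)"
    by (rule Cons.IH[OF c3]) (use Cons.prems in auto)
  then obtain M' where M': "\<forall>j<d. M' j = x j" "M' d = ?M d + (\<Sum>j\<leftarrow>js. a j * x j)"
    "\<And>n b. exec P (pc + 3 * length (j # js), M') n b \<Longrightarrow> exec P (pc + 3, ?M) (3 * length js + n) b"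
    by (auto simp: algebra_simps numeral_3_eq_3)
  have "exec P (pc, M) (3 * length (j # js) + n) b"
    if "exec P (pc + 3 * length (j # js), M') n b" for n b
    using *[OF M'(3)[OF that]] by (simp add: algebra_simps)
  moreover have "M' d = M d + (\<Sum>j\<leftarrow>j # js. a j * x j)"
    using M'(2) Cons.prems(2) j by simp
  ultimately show ?case using M'(1) by blast
qed

text \<open>The accumulator is reset first because earlier tests on the same path have left a value
  in it. The coefficients and the threshold are constants in the code.\<close>

definition branch_code :: "real ^ 'n \<Rightarrow> real \<Rightarrow> nat \<Rightarrow> instr list" where
  "branch_code \<alpha> \<beta> l = (let d = CARD('n) in
     [Const d 0] @ dot_code d (\<lambda>j. \<alpha> $ coord j) [0..<d] @ [Const (Suc d) \<beta>, Jump_Less d (Suc d) l])"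

lemma length_branch_code: "length (branch_code (\<alpha> :: real ^ 'n) \<beta> l) = 3 * CARD('n) + 3"
  by (simp add: branch_code_def Let_def length_dot_code)

lemma sum_list_coord: "(\<Sum>j\<leftarrow>[0..<CARD('n)]. f (coord j :: 'n::finite)) = (\<Sum>i\<in>UNIV. f i)"
proof -
  have "(\<Sum>j\<leftarrow>[0..<CARD('n)]. f (coord j :: 'n)) = (\<Sum>j\<in>{0..<CARD('n)}. f (coord j :: 'n))"
    by (simp add: sum_list_distinct_conv_sum_set)
  also have "\<dots> = (\<Sum>i\<in>UNIV. f i)"
    by (rule sum.reindex_bij_betw[OF bij_betw_coord])
  finally show ?thesis .
qed

lemma exec_branch_code:
  fixes q :: "real ^ 'n"
  assumes "code_at P pc (branch_code \<alpha> \<beta> l)" "\<And>j. j < CARD('n) \<Longrightarrow> M j = q $ coord j"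
  shows "\<exists>M'. (\<forall>j<CARD('n). M' j = q $ coord j) \<and>
    (\<forall>n b. exec P (if \<alpha> \<bullet> q < \<beta> then l else pc + (3 * CARD('n) + 3), M') n b \<longrightarrow>
      exec P (pc, M) (3 * CARD('n) + 3 + n) b)"
proof -
  let ?d = "CARD('n)"
  let ?dot = "dot_code ?d (\<lambda>j. \<alpha> $ coord j) [0..<?d]"
  from assms(1) have c0: "code_at P pc (Const ?d 0 # ?dot @ [Const (Suc ?d) \<beta>, Jump_Less ?d (Suc ?d) l])"
    by (simp add: branch_code_def Let_def)
  note c1 = code_at_ConsD(3)[OF c0]
  have c2: "code_at P (Suc pc + 3 * ?d) [Const (Suc ?d) \<beta>, Jump_Less ?d (Suc ?d) l]"
    using code_at_appendD(2)[OF c1] by (simp add: length_dot_code)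
  note c3 = code_at_ConsD(3)[OF c2]
  obtain M' where M': "\<forall>j<?d. M' j = q $ coord j"
     "M' ?d = (M(?d := 0)) ?d + (\<Sum>j\<leftarrow>[0..<?d]. \<alpha> $ coord j * q $ coord j)"
     "\<And>n b. exec P (Suc pc + 3 * length [0..<?d], M') n b \<Longrightarrow>
        exec P (Suc pc, M(?d := 0)) (3 * length [0..<?d] + n) b"
    using exec_dot_code[OF code_at_appendD(1)[OF c1], of "M(?d := 0)" "\<lambda>j. q $ coord j"] assms(2)
    by auto
  have M'd: "M' ?d = \<alpha> \<bullet> q"
    using M'(2) sum_list_coord[of "\<lambda>i. \<alpha> $ i * q $ i"] by (simp add: inner_vec_def)
  let ?M = "M'(Suc ?d := \<beta>)"
  have "exec P (pc, M) (3 * ?d + 3 + n) b"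
    if "exec P (if \<alpha> \<bullet> q < \<beta> then l else pc + (3 * ?d + 3), ?M) n b" for n b
  proof -
    have "exec P (Suc (Suc pc + 3 * ?d), ?M) (Suc n) b"
      by (rule exec_Cons[OF c3 _ that]) (simp add: M'd algebra_simps numeral_3_eq_3)
    then have "exec P (Suc pc + 3 * ?d, M') (Suc (Suc n)) b"
      by (rule exec_Cons[OF c2, rotated]) auto
    then have "exec P (Suc pc, M(?d := 0)) (3 * ?d + Suc (Suc n)) b"
      using M'(3)[of "Suc (Suc n)" b] by simp
    then have "exec P (pc, M) (Suc (3 * ?d + Suc (Suc n))) b"
      by (rule exec_Cons[OF c0, rotated]) auto
    then show ?thesis by (simp add: algebra_simps numeral_3_eq_3)
  qed
  with M'(1) show ?thesis by (intro exI[of _ ?M]) auto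
qed

text \<open>\<open>pc\<close> is the address where the code will stand. The right subtree directly
  follows its test and is reached by falling through; the left one comes after it, so the jump
  target depends on the length of the code for \<open>r\<close>.\<close>

fun compile :: "nat \<Rightarrow> (real ^ 'n) dtree \<Rightarrow> instr list" where
  "compile pc (Leaf b) = [Answer b]"
| "compile pc (Node \<alpha> \<beta> l r) =
     (let pc' = pc + (3 * CARD('n) + 3); R = compile pc' r; pc'' = pc' + length R
      in branch_code \<alpha> \<beta> pc'' @ R @ compile pc'' l)"

lemma length_compile:
  "length (compile pc (t :: (real ^ 'n) dtree)) \<le> (3 * CARD('n) + 3) * node_count t"
proof (induction t arbitrary: pc)
  case (Node \<alpha> \<beta> l r)
  let ?pc = "pc + (3 * CARD('n) + 3)"
  from Node(2)[of ?pc] Node(1)[of "?pc + length (compile ?pc r)"]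
  show ?case by (simp add: Let_def length_branch_code algebra_simps)
qed simp

text \<open>Only one child of each node is run, so time follows the depth; the additional 1 is the
  final \<open>Answer\<close>. Cells other than the coordinates are left unconstrained because
  preceding tests have altered some of them.\<close>

lemma exec_compile:
  fixes q :: "real ^ 'n"
  assumes "code_at P pc (compile pc t)" "\<And>j. j < CARD('n) \<Longrightarrow> M j = q $ coord j"
  shows "\<exists>n \<le> (3 * CARD('n) + 3) * depth t + 1. exec P (pc, M) n (decide t q)"
  using assms
proof (induction t arbitrary: pc M)
  case (Leaf b)
  then have "exec P (pc, M) 1 b"
    using code_at_ConsD[of P pc "Answer b" "[]"] by (intro exec.answer) simp_all
  then show ?case by (intro exI[of _ 1]) simp
next
  case (Node \<alpha> \<beta> l r)
  define k where "k = 3 * CARD('n) + 3"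
  let ?R = "compile (pc + k) r"
  let ?pc = "pc + k + length ?R"
  from Node.prems(1) have c: "code_at P pc (branch_code \<alpha> \<beta> ?pc @ ?R @ compile ?pc l)"
    by (simp add: Let_def k_def)
  have cr: "code_at P (pc + k) ?R" and cl: "code_at P ?pc (compile ?pc l)"
    using code_at_appendD[OF code_at_appendD(2)[OF c]] by (simp_all add: length_branch_code k_def)
  obtain M' where M': "\<forall>j<CARD('n). M' j = q $ coord j"
    and run: "\<And>n b. exec P (if \<alpha> \<bullet> q < \<beta> then ?pc else pc + k, M') n b \<Longrightarrow> exec P (pc, M) (k + n) b"
    using exec_branch_code[OF code_at_appendD(1)[OF c] Node.prems(2)] unfolding k_def by blast
  have "\<exists>n \<le> k * max (depth l) (depth r) + 1.
    exec P (if \<alpha> \<bullet> q < \<beta> then ?pc else pc + k, M') n (decide (Node \<alpha> \<beta> l r) q)"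
  proof (cases "\<alpha> \<bullet> q < \<beta>")
    case True
    obtain n where "n \<le> k * depth l + 1" "exec P (?pc, M') n (decide l q)"
      using Node.IH(1)[OF cl, of M'] M' unfolding k_def by blast
    moreover have "k * depth l \<le> k * max (depth l) (depth r)" by simp
    ultimately show ?thesis using True by (intro exI[of _ n] conjI) (linarith, simp)
  next
    case False
    obtain n where "n \<le> k * depth r + 1" "exec P (pc + k, M') n (decide r q)"
      using Node.IH(2)[OF cr, of M'] M' unfolding k_def by blast
    moreover have "k * depth r \<le> k * max (depth l) (depth r)" by simp
    ultimately show ?thesis using False by (intro exI[of _ n] conjI) (linarith, simp)
  qed
  then obtain n where n: "n \<le> k * max (depth l) (depth r) + 1"
    "exec P (pc, M) (k + n) (decide (Node \<alpha> \<beta> l r) q)"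
    using run by blast
  have "k + n \<le> k * depth (Node \<alpha> \<beta> l r) + 1"
    using n(1) by simp
  with n(2) show ?case unfolding k_def by blast
qed

lemma dtree_data_structure:
  fixes t :: "(real ^ 'n) dtree"
  obtains D where "storage_space D \<le> (3 * CARD('n) + 3) * node_count t"
    "\<And>q. \<exists>n \<le> (3 * CARD('n) + 3) * depth t + 1. query_result D q n (decide t q)"
proof
  let ?D = "\<lparr>table = [], program = compile 0 t\<rparr>"
  show "storage_space ?D \<le> (3 * CARD('n) + 3) * node_count t"
    using length_compile[of 0 t] by (simp add: storage_space_def)
  have "code_at (compile 0 t) 0 (compile 0 t)"
    unfolding code_at_def by simp
  then show "\<exists>n \<le> (3 * CARD('n) + 3) * depth t + 1. query_result ?D q n (decide t q)" for q
    unfolding query_result_def by (intro exec_compile) (simp_all add: initial_memory_def)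
qed

section \<open>A parallelepiped around a convex body\<close>

lemma norm_axis: "norm (axis i (e :: real) :: real ^ 'n) = \<bar>e\<bar>"
proof -
  have "axis i e = e *\<^sub>R (axis i 1 :: real ^ 'n)" by (simp add: vec_eq_iff axis_def)
  then show ?thesis by simp
qed

text \<open>Closedness is checked row by row, and boundedness holds because the norm of a matrix is
  at most the sum of the norms of its rows. This is what lets the determinant attain its
  maximum.\<close>

lemma compact_rows:
  fixes C :: "(real ^ 'n) set"
  assumes "compact C"
  shows "compact {X :: real ^ 'n ^ 'm. \<forall>i. X $ i \<in> C}"
proof -
  have "closed {X :: real ^ 'n ^ 'm. \<forall>i. X $ i \<in> C}"
    using compact_imp_closed[OF assms]
    by (intro closed_Collect_all) (use closed_vimage_vec_nth in \<open>auto simp: vimage_def\<close>)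
  moreover obtain B where B: "\<And>x. x \<in> C \<Longrightarrow> norm x \<le> B"
    using compact_imp_bounded[OF assms] by (auto simp: bounded_iff)
  have "norm X \<le> of_nat (CARD('m)) * B" if "\<forall>i. X $ i \<in> C" for X :: "real ^ 'n ^ 'm"
  proof -
    have "norm X \<le> (\<Sum>i\<in>UNIV. norm (X $ i))"
      unfolding norm_vec_def by (rule L2_set_le_sum) auto
    also have "\<dots> \<le> of_nat (CARD('m)) * B"
      by (rule sum_bounded_above) (use that B in auto)
    finally show ?thesis .
  qed
  then have "bounded {X :: real ^ 'n ^ 'm. \<forall>i. X $ i \<in> C}"
    by (auto simp: bounded_iff)
  ultimately show ?thesis by (simp add: compact_eq_bounded_closed)
qed

lemma vector_matrix_mult_sum:
  fixes A :: "real ^ 'n ^ 'm"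
  shows "a v* A = (\<Sum>i\<in>UNIV. a $ i *\<^sub>R A $ i)"
  by (simp add: vec_eq_iff vector_matrix_mult_def)

text \<open>The rows of \<open>A\<close> are edge vectors from \<open>x0\<close> maximising the
  absolute determinant, and \<open>a v* A\<close> combines them with coefficients \<open>a\<close>.
  A coefficient beyond 1 in absolute value would allow an exchange of rows that increases the
  determinant.\<close>

lemma convex_body_frame:
  fixes K :: "(real ^ 'n) set"
  assumes "open_convex_body K"
  obtains x0 and A :: "real ^ 'n ^ 'n" where "x0 \<in> K" "det A \<noteq> 0"
    "\<And>i. x0 + A $ i \<in> closure K"
    "\<And>z. z \<in> closure K \<Longrightarrow> \<exists>a. (\<forall>i. \<bar>a $ i\<bar> \<le> 1) \<and> z = x0 + a v* A"
proof -
  from assms have K: "K \<noteq> {}" "bounded K" "open K" by (auto simp: open_convex_body_def)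
  then obtain x0 where x0: "x0 \<in> K" by blast
  let ?C = "(\<lambda>x. x - x0) ` closure K"
  let ?S = "{X :: real ^ 'n ^ 'n. \<forall>i. X $ i \<in> ?C}"
  have "compact ?C"
    using K(2) compact_translation_subtract[of "closure K" x0] by simp
  then have "compact ?S" by (rule compact_rows)
  from K x0 obtain e where e: "e > 0" "cball x0 e \<subseteq> K" by (auto simp: open_contains_cball)
  \<comment> \<open>A small multiple of the identity is an admissible competitor, so the maximal
    determinant is nonzero.\<close>
  have eS: "mat e \<in> ?S"
  proof -
    have "mat e $ i = (x0 + axis i e) - x0" for i :: 'n
      by (auto simp: vec_eq_iff mat_def axis_def)
    moreover have "x0 + axis i e \<in> closure K" for i :: 'n
    proof -
      have "x0 + axis i e \<in> cball x0 e" using e by (simp add: dist_norm norm_axis)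
      with e show ?thesis using closure_subset by blast
    qed
    ultimately show ?thesis by blast
  qed
  have "continuous_on ?S (\<lambda>X. \<bar>det X\<bar>)"
    unfolding det_def by (intro continuous_intros)
  with \<open>compact ?S\<close> eS obtain A where A: "A \<in> ?S" "\<And>X. X \<in> ?S \<Longrightarrow> \<bar>det X\<bar> \<le> \<bar>det A\<bar>"
    using continuous_attains_sup[of ?S "\<lambda>X. \<bar>det X\<bar>"] by blast
  have "det (mat e :: real ^ 'n ^ 'n) = (\<Prod>i\<in>UNIV. (mat e :: real ^ 'n ^ 'n) $ i $ i)"
    by (rule det_diagonal) (auto simp: mat_def)
  then have "det (mat e :: real ^ 'n ^ 'n) \<noteq> 0"
    using e by (simp add: mat_def)
  with A(2)[OF eS] have dA: "det A \<noteq> 0" by auto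
  have "\<exists>a. (\<forall>i. \<bar>a $ i\<bar> \<le> 1) \<and> z = x0 + a v* A" if z: "z \<in> closure K" for z
  proof -
    have "invertible A" using dA by (simp add: invertible_det_nz)
    then obtain B where "B ** A = mat 1" by (auto simp: invertible_def)
    define a where "a = (z - x0) v* B"
    have a: "a v* A = z - x0"
      by (simp add: a_def vector_matrix_mul_assoc \<open>B ** A = mat 1\<close>)
    have "\<bar>a $ i\<bar> \<le> 1" for i
    proof -
      \<comment> \<open>Replacing row \<open>i\<close> by \<open>z - x0\<close> multiplies the
        determinant by \<open>a $ i\<close>, by Cramer's rule.\<close>
      let ?X = "\<chi> k. if k = i then z - x0 else A $ k"
      have "z - x0 = (\<Sum>k\<in>UNIV. a $ k *s row k A)"
        using a by (simp add: vector_matrix_mult_sum row_def scalar_mult_eq_scaleR)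
      then have "det ?X = a $ i * det A"
        using cramer_lemma_transpose[of i a A] by (simp add: row_def cong: if_cong)
      moreover have "?X \<in> ?S" using A(1) z by auto
      then have "\<bar>det ?X\<bar> \<le> \<bar>det A\<bar>" by (rule A(2))
      ultimately show ?thesis using dA by (simp add: abs_mult)
    qed
    with a show ?thesis by (intro exI[of _ a]) auto
  qed
  moreover have "x0 + A $ i \<in> closure K" for i
  proof -
    from A(1) obtain y where "y \<in> closure K" "A $ i = y - x0" by blast
    then show ?thesis by simp
  qed
  ultimately show ?thesis using x0 dA that by blast
qed

text \<open>The point is the average over \<open>i\<close> of the points dividing the segment from
  \<open>x0\<close> to \<open>x0 + A $ i\<close> in ratio \<open>?d * a $ i\<close>, each of which
  lies in \<open>C\<close>.\<close>

lemma cube_subset_convex: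
  fixes A :: "real ^ 'n ^ 'm"
  assumes C: "convex C" and x0: "x0 \<in> C" and A: "\<And>i. x0 + A $ i \<in> C"
    and a: "\<And>i. 0 \<le> a $ i" "\<And>i. real CARD('m) * a $ i \<le> 1"
  shows "x0 + a v* A \<in> C"
proof -
  let ?d = "real CARD('m)"
  have "(1 - ?d * a $ i) *\<^sub>R x0 + (?d * a $ i) *\<^sub>R (x0 + A $ i) \<in> C" for i
    using a by (intro convexD[OF C x0 A]) auto
  then have "(\<Sum>i\<in>UNIV. (1 / ?d) *\<^sub>R ((1 - ?d * a $ i) *\<^sub>R x0 + (?d * a $ i) *\<^sub>R (x0 + A $ i))) \<in> C"
    by (intro convex_sum C) auto
  also have "(\<Sum>i\<in>UNIV. (1 / ?d) *\<^sub>R ((1 - ?d * a $ i) *\<^sub>R x0 + (?d * a $ i) *\<^sub>R (x0 + A $ i)))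
      = (\<Sum>i\<in>UNIV. (1 / ?d) *\<^sub>R x0 + a $ i *\<^sub>R A $ i)"
    by (rule sum.cong) (simp_all add: algebra_simps)
  also have "\<dots> = x0 + a v* A"
    by (simp add: sum.distrib vector_matrix_mult_sum sum_constant_scaleR del: sum_constant)
  finally show ?thesis .
qed

text \<open>
  The translates of \<open>S\<close> by multiples of \<open>\<plusminus> A $ i / m\<close> are disjoint as \<open>v\<close> separates them, and
  \<open>m\<close> of them fit into the doubled parallelepiped, a translate of the cube scaled by \<open>4 d\<close>.
\<close>
lemma measure_slab_le:
  fixes A :: "real ^ 'n ^ 'n" and v :: "real ^ 'n"
  assumes C: "compact C"
    and cube: "\<And>a. (\<And>i. 0 \<le> a $ i) \<Longrightarrow> (\<And>i. real CARD('n) * a $ i \<le> 1) \<Longrightarrow> x0 + a v* A \<in> C"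
    and S: "S \<in> lmeasurable" "\<And>z. z \<in> S \<Longrightarrow> \<exists>a. (\<forall>i. \<bar>a $ i\<bar> \<le> 1) \<and> z = x0 + a v* A"
    and slab: "\<And>z. z \<in> S \<Longrightarrow> s \<le> v \<bullet> z \<and> v \<bullet> z < t"
    and width: "real m * (t - s) \<le> \<bar>v \<bullet> A $ i\<bar>" and m: "m \<ge> 1"
  shows "real m * measure lebesgue S \<le> (4 * real CARD('n)) ^ CARD('n) * measure lebesgue C"
proof -
  let ?d = "real CARD('n)"
  \<comment> \<open>The sign makes \<open>v \<bullet> u\<close> nonnegative, and dividing by
    \<open>m\<close> keeps the first \<open>m\<close> translations within one length of
    \<open>A $ i\<close>.\<close>
  define \<tau> where "\<tau> = sgn (v \<bullet> A $ i) / real m"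
  define u where "u = \<tau> *\<^sub>R A $ i"
  define F where "F k = (+) (real k *\<^sub>R u) ` S" for k :: nat
  have "v \<bullet> u = \<bar>v \<bullet> A $ i\<bar> / real m"
    by (simp add: u_def \<tau>_def abs_sgn mult.commute)
  with width m have vu: "t - s \<le> v \<bullet> u" "0 \<le> v \<bullet> u"
    by (simp_all add: pos_le_divide_eq mult.commute)
  have F: "F k \<in> lmeasurable" for k
    unfolding F_def by (rule measurable_translation) (rule S)
  \<comment> \<open>On \<open>S\<close> the values of \<open>v\<close> fill at most a half-open
    interval of length \<open>t - s\<close>, while moving from \<open>F k\<close> to
    \<open>F l\<close> raises them by at least that length.\<close>
  have dis: "disjnt (F k) (F l)" if "k < l" for k l
  proof -
    have False if "z \<in> S" "z' \<in> S" "real k *\<^sub>R u + z = real l *\<^sub>R u + z'" for z z'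
    proof -
      from that(3) have "v \<bullet> (real k *\<^sub>R u + z) = v \<bullet> (real l *\<^sub>R u + z')" by simp
      then have "v \<bullet> z = v \<bullet> z' + (real l - real k) * (v \<bullet> u)" by (simp add: algebra_simps)
      moreover have "1 * (v \<bullet> u) \<le> (real l - real k) * (v \<bullet> u)"
        using \<open>k < l\<close> vu by (intro mult_right_mono) auto
      ultimately show False using slab[OF that(1)] slab[OF that(2)] vu by linarith
    qed
    then show ?thesis by (auto simp: disjnt_def F_def)
  qed
  \<comment> \<open>In frame coordinates this map is \<open>c\<close> to
    \<open>4 * ?d * c - 2\<close>, taking the cube with side from 0 to \<open>1 / ?d\<close> onto
    the one from -2 to 2.\<close>
  define G where "G = (\<lambda>y. (4 * ?d) *\<^sub>R y + (x0 - (4 * ?d) *\<^sub>R x0 - 2 *\<^sub>R (1 v* A))) ` C"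
  have G: "G \<in> lmeasurable"
    unfolding G_def by (intro lmeasurable_compact compact_continuous_image C continuous_intros)
  have "F k \<subseteq> G" if "k < m" for k
  proof
    fix y assume "y \<in> F k"
    then obtain z where z: "z \<in> S" "y = real k *\<^sub>R u + z" by (auto simp: F_def)
    from S(2)[OF z(1)] obtain a where a: "\<And>j. \<bar>a $ j\<bar> \<le> 1" "z = x0 + a v* A" by blast
    define b where "b = a + axis i (real k * \<tau>)"
    have "axis i (real k * \<tau>) v* A = real k *\<^sub>R u"
      by (simp add: vector_matrix_mult_sum u_def axis_def if_distrib[of "\<lambda>x. x *\<^sub>R _"] cong: if_cong)
    then have y: "y = x0 + b v* A"
      by (simp add: z a(2) b_def vector_matrix_left_distrib)
    have "\<bar>real k * \<tau>\<bar> = real k / real m * \<bar>sgn (v \<bullet> A $ i)\<bar>"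
      by (simp add: \<tau>_def abs_mult)
    also have "\<dots> \<le> 1 * 1"
      using \<open>k < m\<close> by (intro mult_mono) (auto simp: sgn_real_def)
    finally have "\<bar>axis i (real k * \<tau>) $ j\<bar> \<le> 1" for j by (simp add: axis_def)
    then have b: "\<bar>b $ j\<bar> \<le> 2" for j
      unfolding b_def using a(1)[of j] abs_triangle_ineq[of "a $ j" "axis i (real k * \<tau>) $ j"]
      by (smt (verit) vector_add_component)
    define c where "c = (1 / (4 * ?d)) *\<^sub>R (b + 2 *\<^sub>R 1)"
    have "x0 + c v* A \<in> C"
    proof (rule cube)
      show "0 \<le> c $ j" for j using b[of j] by (simp add: c_def)
      show "?d * c $ j \<le> 1" for j using b[of j] by (simp add: c_def field_simps)
    qed
    moreover have "y = (4 * ?d) *\<^sub>R (x0 + c v* A) + (x0 - (4 * ?d) *\<^sub>R x0 - 2 *\<^sub>R (1 v* A))"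
      by (simp add: y c_def scaleR_vector_matrix_assoc vector_matrix_left_distrib scaleR_add_right)
    ultimately show "y \<in> G" unfolding G_def by blast
  qed
  then have "measure lebesgue (\<Union>k<m. F k) \<le> measure lebesgue G"
    using F by (intro measure_mono_fmeasurable G) (auto intro!: sets.finite_UN)
  moreover have "measure lebesgue (\<Union>k<m. F k) = (\<Sum>k<m. measure lebesgue (F k))"
  proof (rule measure_UNION')
    show "pairwise (\<lambda>k l. disjnt (F k) (F l)) {..<m}"
      using dis by (auto simp: pairwise_def disjnt_sym nat_neq_iff)
  qed (simp_all add: F)
  moreover have "\<dots> = real m * measure lebesgue S"
    by (simp add: F_def measure_translation)
  moreover have "measure lebesgue G = (4 * ?d) ^ CARD('n) * measure lebesgue C"
    unfolding G_def by (subst measure_lebesgue_affine) simp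
  ultimately show ?thesis by simp
qed

section \<open>Depth under perturbations\<close>

lemma halfspace_depth_le:
  assumes "norm v = 1"
  shows "halfspace_depth K q \<le> measure lebesgue {z \<in> K. v \<bullet> (z - q) \<ge> 0} / measure lebesgue K"
  unfolding halfspace_depth_def
  by (rule cInf_lower) (use assms in \<open>auto intro!: bdd_belowI[of _ 0]\<close>)

lemma halfspace_depth_ge:
  fixes q :: "real ^ 'n"
  assumes "\<And>v. norm v = 1 \<Longrightarrow> c \<le> measure lebesgue {z \<in> K. v \<bullet> (z - q) \<ge> 0} / measure lebesgue K"
  shows "c \<le> halfspace_depth K q"
  unfolding halfspace_depth_def
proof (rule cInf_greatest)
  obtain v :: "real ^ 'n" where "norm v = 1" using vector_choose_size[of 1] by auto
  then show "{measure lebesgue {z \<in> K. v \<bullet> (z - q) \<ge> 0} / measure lebesgue K |v. norm v = 1} \<noteq> {}"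
    by blast
qed (use assms in auto)

text \<open>A hyperplane separating \<open>q\<close> from the closure gives a halfspace at
  \<open>q\<close> that misses \<open>K\<close>, so the depth is at most 0. This confines the
  trimmed region to the parallelepiped and makes the grid finite.\<close>

lemma trimmed_region_subset_closure:
  assumes K: "open_convex_body K" and \<delta>: "0 < \<delta>" and q: "q \<in> trimmed_region K \<delta>"
  shows "q \<in> closure K"
proof (rule ccontr)
  assume "q \<notin> closure K"
  moreover have "convex (closure K)" "K \<noteq> {}" using K by (auto simp: open_convex_body_def)
  ultimately obtain a b where ab: "a \<bullet> q < b" "\<And>z. z \<in> closure K \<Longrightarrow> b < a \<bullet> z"
    using separating_hyperplane_closed_point[of "closure K" q] by auto
  have ab': "a \<bullet> q < a \<bullet> z" if "z \<in> K" for z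
    using ab(1) ab(2)[of z] that closure_subset[of K] by auto
  with \<open>K \<noteq> {}\<close> have "a \<noteq> 0" by auto
  define v where "v = - (a /\<^sub>R norm a)"
  have "\<not> v \<bullet> (z - q) \<ge> 0" if "z \<in> K" for z
    using ab'[OF that] \<open>a \<noteq> 0\<close> by (simp add: v_def inner_diff_right divide_simps)
  then have "{z \<in> K. v \<bullet> (z - q) \<ge> 0} = {}" by blast
  moreover have "norm v = 1" using \<open>a \<noteq> 0\<close> by (simp add: v_def)
  ultimately have "halfspace_depth K q \<le> 0"
    using halfspace_depth_le[of v K q] by (simp only: measure_empty div_0)
  with \<delta> q show False by (simp add: trimmed_region_def)
qed

text \<open>Passing from \<open>p\<close> to \<open>q\<close>, a halfspace loses at most the slab of
  \<open>K\<close> between the two parallel boundaries. The bound on \<open>b\<close> makes this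
  slab so thin that \<open>measure_slab_le\<close> limits its share of the volume to
  \<open>\<epsilon> * \<delta>\<close>.\<close>

lemma trimmed_region_perturb:
  fixes A :: "real ^ 'n ^ 'n"
  assumes K: "open_convex_body K" and x0: "x0 \<in> K"
    and A: "\<And>i. x0 + A $ i \<in> closure K"
    and box: "\<And>z. z \<in> closure K \<Longrightarrow> \<exists>a. (\<forall>i. \<bar>a $ i\<bar> \<le> 1) \<and> z = x0 + a v* A"
    and p: "p \<in> trimmed_region K \<delta>" and q: "q = p + b v* A"
    and b: "\<And>i. real CARD('n) * real m * \<bar>b $ i\<bar> \<le> 1"
    and m: "m \<ge> 1" "(4 * real CARD('n)) ^ CARD('n) \<le> real m * (\<epsilon> * \<delta>)"
  shows "q \<in> trimmed_region K ((1 - \<epsilon>) * \<delta>)"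
  unfolding trimmed_region_def mem_Collect_eq
proof (rule halfspace_depth_ge)
  fix v :: "real ^ 'n" assume v: "norm v = 1"
  let ?d = "real CARD('n)"
  let ?\<mu> = "measure lebesgue :: (real ^ 'n) set \<Rightarrow> real"
  let ?H = "\<lambda>x. {z \<in> K. v \<bullet> (z - x) \<ge> 0}"
  \<comment> \<open>The slab is empty if \<open>v \<bullet> q \<le> v \<bullet> p\<close>, so both
    directions of the shift are treated at once.\<close>
  let ?S = "{z \<in> K. v \<bullet> p \<le> v \<bullet> z \<and> v \<bullet> z < v \<bullet> q}"
  from K have K': "K \<noteq> {}" "bounded K" "open K" "convex K" by (auto simp: open_convex_body_def)
  have mK: "K \<in> lmeasurable" using K' by (simp add: lmeasurable_open)
  have H_eq: "?H x = K \<inter> {z. v \<bullet> z \<ge> v \<bullet> x}" for x by (auto simp: inner_diff_right)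
  have mH: "?H x \<in> lmeasurable" for x
    unfolding H_eq by (intro fmeasurable_Int_fmeasurable mK sets_completionI_sets) simp
  have S_eq: "?S = K \<inter> ({z. v \<bullet> z \<ge> v \<bullet> p} \<inter> {z. v \<bullet> z < v \<bullet> q})" by auto
  have mS: "?S \<in> lmeasurable"
    unfolding S_eq by (intro fmeasurable_Int_fmeasurable mK sets_completionI_sets) simp
  have pos: "?\<mu> K > 0"
    using K' mK by (metis measure_nonneg negligible_iff_measure open_not_negligible order_le_less)

  \<comment> \<open>The row on which \<open>v\<close> is largest bounds all terms of
    \<open>v \<bullet> (b v* A)\<close>, and the slab is stacked along this row.\<close>
  obtain i where "Max (range (\<lambda>j. \<bar>v \<bullet> A $ j\<bar>)) = \<bar>v \<bullet> A $ i\<bar>"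
    using Max_in[of "range (\<lambda>j. \<bar>v \<bullet> A $ j\<bar>)"] by (force simp del: Max_in)
  then have i: "\<bar>v \<bullet> A $ j\<bar> \<le> \<bar>v \<bullet> A $ i\<bar>" for j
    by (metis Max_ge finite finite_imageI rangeI)
  have "(?d * real m) * (v \<bullet> q - v \<bullet> p) = (\<Sum>j\<in>UNIV. (?d * real m * b $ j) * (v \<bullet> A $ j))"
    by (simp add: q inner_add_right vector_matrix_mult_sum inner_sum_right sum_distrib_left mult_ac)
  also have "\<dots> \<le> of_nat CARD('n) * \<bar>v \<bullet> A $ i\<bar>"
  proof (rule sum_bounded_above)
    fix j
    have "(?d * real m * b $ j) * (v \<bullet> A $ j) \<le> \<bar>?d * real m * b $ j\<bar> * \<bar>v \<bullet> A $ j\<bar>"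
      by (metis abs_ge_self abs_mult)
    also have "\<dots> \<le> 1 * \<bar>v \<bullet> A $ i\<bar>"
      using b[of j] i[of j] by (intro mult_mono) (auto simp: abs_mult)
    finally show "(?d * real m * b $ j) * (v \<bullet> A $ j) \<le> \<bar>v \<bullet> A $ i\<bar>" by simp
  qed
  finally have width: "real m * (v \<bullet> q - v \<bullet> p) \<le> \<bar>v \<bullet> A $ i\<bar>" by simp

  have "real m * ?\<mu> ?S \<le> (4 * ?d) ^ CARD('n) * ?\<mu> (closure K)"
  proof (rule measure_slab_le[where s = "v \<bullet> p" and t = "v \<bullet> q"])
    show "compact (closure K)" using K' by simp
    show "x0 + a v* A \<in> closure K" if "\<And>i. 0 \<le> a $ i" "\<And>i. ?d * a $ i \<le> 1" for a
      using that x0 A K' closure_subset[of K] by (intro cube_subset_convex) auto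
    show "\<exists>a. (\<forall>i. \<bar>a $ i\<bar> \<le> 1) \<and> z = x0 + a v* A" if "z \<in> ?S" for z
      using that closure_subset[of K] by (intro box) auto
  qed (use mS width m in auto)
  \<comment> \<open>The frontier of a convex set is a null set.\<close>
  also have "?\<mu> (closure K) = ?\<mu> K"
    using K' by (intro measure_closure negligible_convex_frontier)
  also have "(4 * ?d) ^ CARD('n) * ?\<mu> K \<le> (real m * (\<epsilon> * \<delta>)) * ?\<mu> K"
    using m(2) pos by (intro mult_right_mono) auto
  finally have S: "?\<mu> ?S \<le> \<epsilon> * \<delta> * ?\<mu> K" using m(1) by simp

  have "\<delta> \<le> ?\<mu> (?H p) / ?\<mu> K"
    using p halfspace_depth_le[OF v, of K p] by (simp add: trimmed_region_def)
  then have "\<delta> * ?\<mu> K \<le> ?\<mu> (?H p)" using pos by (simp add: pos_le_divide_eq)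
  also have "\<dots> \<le> ?\<mu> (?H q \<union> ?S)"
    by (intro measure_mono_fmeasurable fmeasurableD fmeasurable.Un mH mS) (auto simp: inner_diff_right)
  also have "\<dots> \<le> ?\<mu> (?H q) + ?\<mu> ?S"
    by (intro measure_Un_le fmeasurableD mH mS)
  finally have "(1 - \<epsilon>) * \<delta> * ?\<mu> K \<le> ?\<mu> (?H q)"
    using S by (simp add: algebra_simps)
  then show "(1 - \<epsilon>) * \<delta> \<le> ?\<mu> (?H q) / ?\<mu> K"
    using pos by (simp add: pos_le_divide_eq)
qed

section \<open>The data structure\<close>

lemma membership_dtree:
  fixes K :: "(real ^ 'n) set"
  assumes K: "open_convex_body K" and \<delta>: "0 < \<delta>"
    and m: "m \<ge> 1" "(4 * real CARD('n)) ^ CARD('n) \<le> real m * (\<epsilon> * \<delta>)"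
  shows "\<exists>t. node_count t \<le> (15 * (CARD('n) * m)) ^ CARD('n) \<and>
    depth t \<le> 4 * CARD('n) * (CARD('n) * m) \<and> (\<forall>q. valid_answer K \<delta> \<epsilon> q (decide t q))"
proof -
  let ?d = "CARD('n)"
  define N where "N = ?d * m"
  have N: "N \<ge> 1" using m(1) by (simp add: N_def Suc_le_eq)
  from convex_body_frame[OF K] obtain x0 and A :: "real ^ 'n ^ 'n" where x0: "x0 \<in> K"
    and dA: "det A \<noteq> 0" and A: "\<And>i. x0 + A $ i \<in> closure K"
    and box: "\<And>z. z \<in> closure K \<Longrightarrow> \<exists>a. (\<forall>i. \<bar>a $ i\<bar> \<le> 1) \<and> z = x0 + a v* A"
    by blast
  from dA have "invertible A" by (simp add: invertible_det_nz)
  then obtain B where B: "A ** B = mat 1" "B ** A = mat 1" by (auto simp: invertible_def)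
  \<comment> \<open>The columns of the inverse of \<open>A\<close> are the functionals that read off
    frame coordinates.\<close>
  have coord: "(x v* B) $ i = column i B \<bullet> x" for x i
    by (simp add: vector_matrix_mult_def column_def inner_vec_def mult.commute)
  \<comment> \<open>After scaling by \<open>N\<close>, unit cells have width \<open>1 / N\<close> in
    frame coordinates, which is the shift that \<open>trimmed_region_perturb\<close> tolerates. The
    offset \<open>\<beta>\<close> corresponds to coordinate -1.\<close>
  define \<alpha> where "\<alpha> i = real N *\<^sub>R column i B" for i
  define \<beta> where "\<beta> i = \<alpha> i \<bullet> x0 - real N" for i
  define fs where "fs = map (\<lambda>j. (\<alpha> (coord j), \<beta> (coord j))) [0..<?d]"
  have set_fs: "set fs = range (\<lambda>i. (\<alpha> i, \<beta> i))"
    using bij_betw_imp_surj_on[OF bij_betw_coord[where 'n = 'n]]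
    by (simp add: fs_def image_image[symmetric, of _ coord, where f = "\<lambda>i. (\<alpha> i, \<beta> i)"])
  let ?P = "trimmed_region K \<delta>"
  \<comment> \<open>The scaled coordinates fill a closed interval of length \<open>2 * N\<close>;
    one more half-open slice catches its right end.\<close>
  have range: "\<beta> i \<le> \<alpha> i \<bullet> p \<and> \<alpha> i \<bullet> p < \<beta> i + real (2 * N + 1)" if "p \<in> ?P" for p i
  proof -
    from that have "p \<in> closure K" by (rule trimmed_region_subset_closure[OF K \<delta>])
    from box[OF this] obtain a where a: "\<And>i. \<bar>a $ i\<bar> \<le> 1" "p = x0 + a v* A" by blast
    have "column i B \<bullet> (a v* A) = a $ i"
      using coord[of "a v* A" i] by (simp add: vector_matrix_mul_assoc B)
    then have "\<alpha> i \<bullet> p = \<alpha> i \<bullet> x0 + real N * a $ i"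
      by (simp add: a(2) \<alpha>_def inner_add_right distrib_left)
    moreover have "\<bar>real N * a $ i\<bar> \<le> real N"
      using a(1)[of i] by (simp add: abs_mult mult_left_le)
    ultimately show ?thesis by (auto simp: \<beta>_def abs_le_iff)
  qed
  obtain t where t: "node_count t \<le> (5 * (2 * N + 1)) ^ length fs"
      "depth t \<le> length fs * ((2 * N + 1) + 1)" "\<And>q. q \<in> ?P \<Longrightarrow> decide t q"
      "\<And>q. decide t q \<Longrightarrow> \<exists>p\<in>?P. \<forall>(\<alpha>, \<beta>)\<in>set fs. \<bar>\<alpha> \<bullet> q - \<alpha> \<bullet> p\<bar> < 1"
  proof -
    have "\<exists>t. node_count t \<le> (5 * (2 * N + 1)) ^ length fs \<and> depth t \<le> length fs * ((2 * N + 1) + 1) \<and>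
      (\<forall>q\<in>?P. decide t q) \<and>
      (\<forall>q. decide t q \<longrightarrow> (\<exists>p\<in>?P. \<forall>(\<alpha>, \<beta>)\<in>set fs. \<bar>\<alpha> \<bullet> q - \<alpha> \<bullet> p\<bar> < 1))"
      by (rule grid_dtree) (use range in \<open>auto simp: set_fs\<close>)
    with that show ?thesis by blast
  qed
  have "valid_answer K \<delta> \<epsilon> q (decide t q)" for q
  proof -
    have "q \<in> trimmed_region K ((1 - \<epsilon>) * \<delta>)" if "decide t q"
    proof -
      from t(4)[OF that] obtain p where p: "p \<in> ?P" "\<And>i. \<bar>\<alpha> i \<bullet> q - \<alpha> i \<bullet> p\<bar> < 1"
        by (auto simp: set_fs)
      define b where "b = (q - p) v* B"
      have "q = p + b v* A" by (simp add: b_def vector_matrix_mul_assoc B)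
      moreover have "real ?d * real m * \<bar>b $ i\<bar> \<le> 1" for i
      proof -
        have "real N * b $ i = \<alpha> i \<bullet> q - \<alpha> i \<bullet> p"
          by (simp add: b_def coord \<alpha>_def inner_diff_right right_diff_distrib)
        then have "\<bar>real N * b $ i\<bar> \<le> 1" using p(2)[of i] by simp
        then show ?thesis by (simp add: N_def abs_mult)
      qed
      ultimately show ?thesis
        using trimmed_region_perturb[OF K x0 A box p(1) _ _ m] by blast
    qed
    with t(3) show ?thesis by (auto simp: valid_answer_def)
  qed
  moreover have "node_count t \<le> (15 * N) ^ ?d"
  proof -
    have "(5 * (2 * N + 1)) ^ ?d \<le> (15 * N) ^ ?d" using N by (intro power_mono) auto
    with t(1) show ?thesis by (simp add: fs_def)
  qed
  moreover have "depth t \<le> 4 * ?d * N"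
  proof -
    have "depth t \<le> ?d * (2 * N + 2)" using t(2) by (simp add: fs_def)
    also have "\<dots> \<le> ?d * (4 * N)" using N by (intro mult_le_mono2) simp
    finally show ?thesis by simp
  qed
  ultimately show ?thesis unfolding N_def by blast
qed

lemma nat_ceiling_bounds:
  assumes "(1::real) \<le> x"
  shows "1 \<le> nat \<lceil>x\<rceil>" "x \<le> real (nat \<lceil>x\<rceil>)" "real (nat \<lceil>x\<rceil>) \<le> 2 * x"
  using assms by linarith+

theorem theorem3p1:
  shows "\<exists>c::real. c > 0 \<and>
    (\<forall>(K :: (real ^ 'n) set) (\<delta>::real) (\<epsilon>::real).
       open_convex_body K \<longrightarrow> 0 < \<delta> \<longrightarrow> \<delta> \<le> 1 / 2 \<longrightarrow> trimmed_region K \<delta> \<noteq> {} \<longrightarrow>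
       0 < \<epsilon> \<longrightarrow> \<epsilon> < 1 \<longrightarrow>
       (\<exists>D. real (storage_space D)
              \<le> c * (1 / (\<epsilon> ^ CARD('n) * \<delta> powr ((3 * real CARD('n) - 1) / 2))) \<and>
            (\<forall>q :: real ^ 'n. \<exists>n b. query_result D q n b \<and> valid_answer K \<delta> \<epsilon> q b \<and>
               real n \<le> c * (1 / (\<epsilon> * \<delta>)) * ln (1 / \<delta>))))"
proof -
  let ?d = "CARD('n)"
  \<comment> \<open>\<open>k\<close> bounds the instructions per tree node,
    \<open>C / (\<epsilon> * \<delta>)\<close> will bound the number \<open>N\<close> of cells per
    unit of frame coordinate, and \<open>c1\<close> and \<open>c2\<close> serve storage and time.
    The 2 in \<open>C\<close> pays for rounding up, the 2 in \<open>c2\<close> for the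
    logarithm.\<close>
  define k where "k = 3 * ?d + 3"
  define C where "C = 2 * real ?d * (4 * real ?d) ^ ?d"
  define c1 where "c1 = real k * (15 * C) ^ ?d"
  define c2 where "c2 = 2 * ((real k * (4 * real ?d) + 1) * C)"
  have d: "real ?d \<ge> 1" by (simp add: Suc_le_eq)
  then have "(4 * real ?d) ^ ?d \<ge> 1" by (intro one_le_power) linarith
  then have C: "C > 0" using d by (simp add: C_def)
  have c: "c1 > 0" "c2 > 0" using C by (simp_all add: c1_def c2_def k_def add_pos_nonneg)
  have main: "\<exists>D. real (storage_space D)
              \<le> (c1 + c2) * (1 / (\<epsilon> ^ ?d * \<delta> powr ((3 * real ?d - 1) / 2))) \<and>
            (\<forall>q :: real ^ 'n. \<exists>n b. query_result D q n b \<and> valid_answer K \<delta> \<epsilon> q b \<and>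
               real n \<le> (c1 + c2) * (1 / (\<epsilon> * \<delta>)) * ln (1 / \<delta>))"
    if K: "open_convex_body K" and \<delta>: "0 < \<delta>" "\<delta> \<le> 1 / 2" and \<epsilon>: "0 < \<epsilon>" "\<epsilon> < 1"
    for K :: "(real ^ 'n) set" and \<delta> \<epsilon> :: real
  proof -
    have e: "0 < \<epsilon> * \<delta>" "\<epsilon> * \<delta> \<le> 1"
      using \<delta> \<epsilon> mult_mono[of \<epsilon> 1 \<delta> 1] by auto
    \<comment> \<open>The smallest real value that could take the place of \<open>m\<close> in the
      hypothesis of \<open>membership_dtree\<close>.\<close>
    define x where "x = (4 * real ?d) ^ ?d / (\<epsilon> * \<delta>)"
    have "x \<ge> 1"
      using e \<open>(4 * real ?d) ^ ?d \<ge> 1\<close> unfolding x_def by (subst pos_le_divide_eq) linarith+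
    define m where "m = nat \<lceil>x\<rceil>"
    define N where "N = ?d * m"
    note mx = nat_ceiling_bounds[OF \<open>x \<ge> 1\<close>, folded m_def]
    have "(4 * real ?d) ^ ?d = x * (\<epsilon> * \<delta>)" using \<delta> \<epsilon> by (simp add: x_def)
    also have "\<dots> \<le> real m * (\<epsilon> * \<delta>)" using mx e by (intro mult_right_mono) auto
    finally obtain t :: "(real ^ 'n) dtree" where t: "node_count t \<le> (15 * N) ^ ?d"
        "depth t \<le> 4 * ?d * N" "\<And>q. valid_answer K \<delta> \<epsilon> q (decide t q)"
      using membership_dtree[OF K \<delta>(1) mx(1)] unfolding N_def by blast
    obtain D where D: "storage_space D \<le> k * node_count t"
        "\<And>q. \<exists>n \<le> k * depth t + 1. query_result D q n (decide t q)"
      unfolding k_def using dtree_data_structure[of t] by blast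
    have "real N \<le> real ?d * (2 * x)" unfolding N_def using mx(3) by simp
    also have "\<dots> = C / (\<epsilon> * \<delta>)" by (simp add: x_def C_def)
    finally have N: "real N \<le> C / (\<epsilon> * \<delta>)" .
    have "N \<ge> 1" using mx(1) by (simp add: N_def Suc_le_eq)

    have "real (storage_space D) \<le> real (k * (15 * N) ^ ?d)"
      using D(1) t(1) by (intro of_nat_mono) (meson mult_le_mono2 order_trans)
    also have "\<dots> = real k * (15 * real N) ^ ?d" by simp
    also have "\<dots> \<le> real k * (15 * (C / (\<epsilon> * \<delta>))) ^ ?d"
      using N by (intro mult_left_mono power_mono) auto
    also have "\<dots> = c1 * (1 / (\<epsilon> ^ ?d * \<delta> ^ ?d))"
      by (simp add: c1_def power_divide power_mult_distrib)
    also have "\<dots> \<le> (c1 + c2) * (1 / (\<epsilon> ^ ?d * \<delta> powr ((3 * real ?d - 1) / 2)))"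
    proof (rule mult_mono)
      \<comment> \<open>For \<open>?d\<close> at least 1 the exponent is at least \<open>?d\<close>,
        and the base is at most 1.\<close>
      have "\<delta> powr ((3 * real ?d - 1) / 2) \<le> \<delta> powr real ?d"
        using d \<delta> by (intro powr_mono') auto
      then have "\<delta> powr ((3 * real ?d - 1) / 2) \<le> \<delta> ^ ?d"
        using \<delta> by (simp add: powr_realpow)
      then show "1 / (\<epsilon> ^ ?d * \<delta> ^ ?d) \<le> 1 / (\<epsilon> ^ ?d * \<delta> powr ((3 * real ?d - 1) / 2))"
        using \<delta> \<epsilon> by (intro divide_left_mono mult_left_mono mult_pos_pos) auto
    qed (use c \<delta> \<epsilon> in auto)
    finally have space: "real (storage_space D)
      \<le> (c1 + c2) * (1 / (\<epsilon> ^ ?d * \<delta> powr ((3 * real ?d - 1) / 2)))" .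

    \<comment> \<open>Since \<open>\<delta> \<le> 1 / 2\<close>, the logarithm is bounded below by a
      positive constant, so a time bound without it suffices.\<close>
    have "ln 2 \<le> ln (1 / \<delta>)" using \<delta> by (subst ln_le_cancel_iff) (auto simp: field_simps)
    then have ln: "1 \<le> 2 * ln (1 / \<delta>)" using ln2_ge_two_thirds by linarith
    have time: "real n \<le> (c1 + c2) * (1 / (\<epsilon> * \<delta>)) * ln (1 / \<delta>)" if "n \<le> k * depth t + 1" for n
    proof -
      have "n \<le> k * (4 * ?d * N) + 1"
        using that t(2) by (meson add_le_mono1 mult_le_mono2 order_trans)
      then have "real n \<le> real (k * (4 * ?d * N) + 1)" by (rule of_nat_mono)
      also have "\<dots> \<le> (real k * (4 * real ?d) + 1) * real N"
        using \<open>N \<ge> 1\<close> by (simp add: algebra_simps)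
      also have "\<dots> \<le> (real k * (4 * real ?d) + 1) * (C / (\<epsilon> * \<delta>))"
        using N by (intro mult_left_mono) auto
      also have "\<dots> \<le> (real k * (4 * real ?d) + 1) * (C / (\<epsilon> * \<delta>)) * (2 * ln (1 / \<delta>))"
        using mult_left_mono[OF ln, of "(real k * (4 * real ?d) + 1) * (C / (\<epsilon> * \<delta>))"] C e
        by simp
      also have "\<dots> = c2 * ((1 / (\<epsilon> * \<delta>)) * ln (1 / \<delta>))"
        by (simp add: c2_def)
      also have "\<dots> \<le> (c1 + c2) * ((1 / (\<epsilon> * \<delta>)) * ln (1 / \<delta>))"
        using c e ln by (intro mult_right_mono) (auto intro!: mult_nonneg_nonneg)
      finally show ?thesis by (simp add: mult.assoc)
    qed
    have "\<exists>n b. query_result D q n b \<and> valid_answer K \<delta> \<epsilon> q b \<and>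
        real n \<le> (c1 + c2) * (1 / (\<epsilon> * \<delta>)) * ln (1 / \<delta>)" for q
      using D(2)[of q] t(3)[of q] time by blast
    with space show ?thesis by blast
  qed
  show ?thesis
    by (rule exI[of _ "c1 + c2"]) (use c main in auto)
qed

end
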